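(* Let $\mathbb{F}_q$ be a finite field of order $q$ and characteristic $p$, and let $n, r \in \mathbb{Z}^+$. For $1 \leq i \leq n$, let $X_i \subset \mathbb{F}_q$ be a Vandermonde set of size divisible by $p$. Let $f_1,\ldots,f_r \in \mathbb{F}_q[t_1,\ldots,t_n]$ be polynomials of positive degree such that \[ (q-1)\sum_{j=1}^r \deg(f_j) < \sum_{i=1}^n (\# X_i-1). \] Let \[ Z_X := \Big\{ x \in \prod_{i=1}^n X_i \ \Big|\ f_1(x) = \ldots = f_r(x) = 0\Big\}. \] Then $p \mid \# Z_X$.
   Context: For a finite subset $Y$ of a field $F$ of characteristic $p>0$ and $k \in \mathbb{Z}^+$, put $\pi_k(Y) := \sum_{y \in Y} y^k \in F$. If $Y$ has size $\#Y \geq 2$, let $\omega(Y)$ be the least $k \in \mathbb{Z}^+$ such that $\pi_k(Y) \neq 0$ (such a $k$ exists, with $k \leq \# Y$). A finite subset $Y \subset F$ with $\# Y \geq 2$ is called Vandermonde if $\omega(Y) = \# Y - 1$. *)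

theory Defs
  imports
    "HOL-Library.Poly_Mapping"
    "HOL-Library.FuncSet"
    "HOL-Library.Cardinality"
    "HOL-Computational_Algebra.Primes"
begin

definition power_sum :: "nat \<Rightarrow> 'a::field_prime_char set \<Rightarrow> 'a" where
  "power_sum k Y = (\<Sum>y\<in>Y. y ^ k)"

(* Meaningful for finite Y with at least two elements; then such a k exists and is at most card Y. *)
definition omega :: "'a::field_prime_char set \<Rightarrow> nat" where
  "omega Y = (LEAST k. 0 < k \<and> power_sum k Y \<noteq> 0)"

definition Vandermonde :: "'a::field_prime_char set \<Rightarrow> bool" where
  "Vandermonde Y \<longleftrightarrow> finite Y \<and> 2 \<le> card Y \<and> omega Y = card Y - 1"

(* A polynomial maps monomials to coefficients, a monomial maps variable indices to exponents;
   both maps have finite support. *)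
type_synonym 'a mpolynomial = "(nat \<Rightarrow>\<^sub>0 nat) \<Rightarrow>\<^sub>0 'a"

(* The polynomials in t_1, ..., t_n. *)
definition polys_in :: "nat \<Rightarrow> 'a::zero mpolynomial set" where
  "polys_in n = {f. \<forall>m\<in>Poly_Mapping.keys f. Poly_Mapping.keys m \<subseteq> {1..n}}"

definition monom_degree :: "(nat \<Rightarrow>\<^sub>0 nat) \<Rightarrow> nat" where
  "monom_degree m = (\<Sum>i\<in>Poly_Mapping.keys m. Poly_Mapping.lookup m i)"

(* Inserting 0 only matters for the zero polynomial, which gets degree 0. *)
definition total_degree :: "'a::zero mpolynomial \<Rightarrow> nat" where
  "total_degree f = Max (insert 0 (monom_degree ` Poly_Mapping.keys f))"

definition eval_mpoly :: "'a::comm_semiring_1 mpolynomial \<Rightarrow> (nat \<Rightarrow> 'a) \<Rightarrow> 'a" where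
  "eval_mpoly f x = (\<Sum>m\<in>Poly_Mapping.keys f. Poly_Mapping.lookup f m *
      (\<Prod>i\<in>Poly_Mapping.keys m. x i ^ Poly_Mapping.lookup m i))"

end

theory Submission
  imports Defs
begin

(* Chevalley's method: since y^(q-1) is the indicator of y \<noteq> 0, the count of Z_X in F_q is the sum of
   the polynomial \<Prod>j. (1 - (f j)^(q-1)) over the grid. By the degree hypothesis each of its monomials
   has, for some i, an exponent k < card (X i) - 1. Summing that monomial over the grid gives a
   multiple of the k-th power sum of X i, which vanishes: for k > 0 by the Vandermonde condition,
   for k = 0 because p divides card (X i). *)

(* Working with polynomial functions, graded by a degree bound d, avoids multiplying formal
   multivariate polynomials. *)
inductive poly_fun :: "'i set \<Rightarrow> nat \<Rightarrow> (('i \<Rightarrow> 'a::comm_ring_1) \<Rightarrow> 'a) \<Rightarrow> bool"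
  for I :: "'i set" and d :: nat where
  monom: "(\<Sum>i\<in>I. k i) \<le> d \<Longrightarrow> poly_fun I d (\<lambda>x. c * (\<Prod>i\<in>I. x i ^ k i))"
| add: "poly_fun I d g \<Longrightarrow> poly_fun I d h \<Longrightarrow> poly_fun I d (\<lambda>x. g x + h x)"

lemma poly_fun_const: "poly_fun I d (\<lambda>x. c)"
  using poly_fun.monom[where k = "\<lambda>_. 0"] by simp

lemma poly_fun_sum:
  assumes "\<And>a. a \<in> A \<Longrightarrow> poly_fun I d (g a)"
  shows "poly_fun I d (\<lambda>x. \<Sum>a\<in>A. g a x)"
  using assms
  by (induction A rule: infinite_finite_induct) (auto intro: poly_fun_const poly_fun.add)

lemma poly_fun_mult:
  assumes "poly_fun I d g" and "poly_fun I e h"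
  shows "poly_fun I (d + e) (\<lambda>x. g x * h x)"
  using assms(1)
\<comment> \<open>The induction on \<open>g\<close> reduces to a monomial first factor, and the
  inner induction on \<open>h\<close> to a monomial second factor; there exponents add up.\<close>
proof induction
  case (monom k c)
  note k = this
  show ?case
    using assms(2)
  proof induction
    case (monom l b)
    have "poly_fun I (d + e) (\<lambda>x. (c * b) * (\<Prod>i\<in>I. x i ^ (k i + l i)))"
      using k monom by (intro poly_fun.monom) (simp add: sum.distrib)
    then show ?case
      by (simp add: power_add prod.distrib mult_ac)
  next
    case (add g h)
    then show ?case
      using poly_fun.add[OF add.IH] by (simp add: distrib_left)
  qed
next
  case (add g1 g2)
  then show ?case
    using poly_fun.add[OF add.IH] by (simp add: distrib_right)
qed

lemma poly_fun_prod:
  assumes "\<And>a. a \<in> A \<Longrightarrow> poly_fun I (d a) (g a)"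
  shows "poly_fun I (\<Sum>a\<in>A. d a) (\<lambda>x. \<Prod>a\<in>A. g a x)"
  using assms
  by (induction A rule: infinite_finite_induct) (auto intro: poly_fun_const poly_fun_mult)

lemma poly_fun_power:
  assumes "poly_fun I d g"
  shows "poly_fun I (m * d) (\<lambda>x. g x ^ m)"
  using poly_fun_prod[of "{..<m}" I "\<lambda>_. d" "\<lambda>_. g"] assms by simp

lemma poly_fun_one_minus:
  assumes "poly_fun I d g"
  shows "poly_fun I d (\<lambda>x. 1 - g x)"
  using poly_fun.add[OF poly_fun_const[of I d 1]
      poly_fun_mult[OF poly_fun_const[of I 0 "- 1"] assms, simplified]]
  by simp

text \<open>Links formal polynomials to \<open>poly_fun\<close>: since the variables of
  \<open>f\<close> lie in \<open>{1..n}\<close>, each monomial can be padded with exponents 0 to a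
  product over all of \<open>{1..n}\<close> without changing its degree or value.\<close>

lemma poly_fun_eval_mpoly:
  fixes f :: "'a::comm_ring_1 mpolynomial"
  assumes "f \<in> polys_in n"
  shows "poly_fun {1..n} (total_degree f) (eval_mpoly f)"
proof -
  have "poly_fun {1..n} (total_degree f) (\<lambda>x. Poly_Mapping.lookup f m *
      (\<Prod>i\<in>Poly_Mapping.keys m. x i ^ Poly_Mapping.lookup m i))"
    if m: "m \<in> Poly_Mapping.keys f" for m
  proof -
    have sub: "Poly_Mapping.keys m \<subseteq> {1..n}"
      using assms m by (auto simp: polys_in_def)
    have "(\<Sum>i\<in>{1..n}. Poly_Mapping.lookup m i) = monom_degree m"
      unfolding monom_degree_def
      by (rule sum.mono_neutral_right) (use sub in \<open>auto simp: in_keys_iff\<close>)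
    also have "\<dots> \<le> total_degree f"
      unfolding total_degree_def using m by (intro Max_ge) auto
    finally have "poly_fun {1..n} (total_degree f) (\<lambda>x. Poly_Mapping.lookup f m *
        (\<Prod>i\<in>{1..n}. x i ^ Poly_Mapping.lookup m i))"
      by (rule poly_fun.monom)
    moreover have "(\<Prod>i\<in>{1..n}. x i ^ Poly_Mapping.lookup m i) =
        (\<Prod>i\<in>Poly_Mapping.keys m. x i ^ Poly_Mapping.lookup m i)" for x :: "nat \<Rightarrow> 'a"
      by (rule prod.mono_neutral_right) (use sub in \<open>auto simp: in_keys_iff\<close>)
    ultimately show ?thesis
      by simp
  qed
  then show ?thesis
    unfolding eval_mpoly_def[abs_def] by (rule poly_fun_sum)
qed

lemma sum_grid_poly_fun_eq_0:
  fixes g :: "('i \<Rightarrow> 'a::field_prime_char) \<Rightarrow> 'a"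
  assumes "finite I" and "\<And>i. i \<in> I \<Longrightarrow> finite (X i)"
    and small: "\<And>i k. i \<in> I \<Longrightarrow> k < s i \<Longrightarrow> power_sum k (X i) = 0"
    and "poly_fun I d g" and "d < (\<Sum>i\<in>I. s i)"
  shows "(\<Sum>x\<in>PiE I X. g x) = 0"
  using assms(4)
proof induction
  case (monom k c)
  \<comment> \<open>Otherwise \<open>s i \<le> k i\<close> for all \<open>i\<close>, and summing
    would give a total of at most \<open>d\<close> for \<open>s\<close>.\<close>
  have "\<exists>i\<in>I. k i < s i"
    using monom assms(5) sum_mono[of I s k] by (meson leD not_less order_trans)
  then have "(\<Prod>i\<in>I. power_sum (k i) (X i)) = 0"
    using small \<open>finite I\<close> by auto
  then show ?case
    \<comment> \<open>By distributivity, the sum of a monomial over the grid factors into one power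
      sum per coordinate.\<close>
    using assms(1,2) by (simp add: power_sum_def prod_sum_PiE flip: sum_distrib_left)
next
  case (add g h)
  then show ?case
    by (simp add: sum.distrib)
qed

lemma Vandermonde_power_sum_eq_0:
  fixes Y :: "'a::field_prime_char set"
  assumes "Vandermonde Y" and "CHAR('a) dvd card Y" and "k < card Y - 1"
  shows "power_sum k Y = 0"
proof (cases "k = 0")
  case True
  then show ?thesis
    using assms(2) by (simp add: power_sum_def of_nat_eq_0_iff_char_dvd)
next
  case False
  have "k < omega Y"
    using assms by (simp add: Vandermonde_def)
  then show ?thesis
    using False not_less_Least[of k "\<lambda>k. 0 < k \<and> power_sum k Y \<noteq> 0"] by (simp add: omega_def)
qed

lemma one_minus_power_card:
  fixes y :: "'a::finite_field"
  shows "1 - y ^ (CARD('a) - 1) = of_bool (y = 0)"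
proof (cases "y = 0")
  case True
  \<comment> \<open>A field has at least two elements, so the exponent is positive and
    \<open>0 ^ (CARD('a) - 1)\<close> is 0 rather than 1.\<close>
  have "card {0, 1 :: 'a} \<le> CARD('a)"
    by (rule card_mono) auto
  then show ?thesis
    using True by simp
next
  case False
  have "y * y ^ (CARD('a) - 1) = y"
    using finite_field_power_card_eq_same[of y] power_minus_mult[of "CARD('a)" y]
    by (simp add: mult.commute)
  then show ?thesis
    using False by simp
qed

theorem theorem1p6:
  fixes X :: "nat \<Rightarrow> 'a::finite_field set"
    and f :: "nat \<Rightarrow> 'a mpolynomial"
    and n r p q :: nat
  assumes "q = CARD('a)" and "p = CHAR('a)"
    and "1 \<le> n" and "1 \<le> r"
    and "\<And>i. i \<in> {1..n} \<Longrightarrow> Vandermonde (X i)"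
    and "\<And>i. i \<in> {1..n} \<Longrightarrow> p dvd card (X i)"
    and "\<And>j. j \<in> {1..r} \<Longrightarrow> f j \<in> polys_in n"
    and "\<And>j. j \<in> {1..r} \<Longrightarrow> 0 < total_degree (f j)"
    and "(q - 1) * (\<Sum>j=1..r. total_degree (f j)) < (\<Sum>i=1..n. card (X i) - 1)"
  shows "p dvd card {x \<in> PiE {1..n} X. \<forall>j\<in>{1..r}. eval_mpoly (f j) x = 0}"
proof -
  \<comment> \<open>Each factor is 1 at the zeros of \<open>f j\<close> and 0 elsewhere, so
    \<open>g\<close> is the indicator of the common zeros.\<close>
  define g where "g x = (\<Prod>j=1..r. 1 - eval_mpoly (f j) x ^ (q - 1))" for x
  have fin: "finite (PiE {1..n} X)"
    by (intro finite_PiE) auto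
  have "poly_fun {1..n} (\<Sum>j=1..r. (q - 1) * total_degree (f j)) g"
    unfolding g_def[abs_def]
    by (intro poly_fun_prod poly_fun_one_minus poly_fun_power poly_fun_eval_mpoly assms(7))
  then have "(\<Sum>x\<in>PiE {1..n} X. g x) = 0"
    \<comment> \<open>The rotation puts the \<open>poly_fun\<close> premise first, to match the
      chained degree bound.\<close>
    by (rule sum_grid_poly_fun_eq_0[where s = "\<lambda>i. card (X i) - 1", rotated 3])
      (use assms in \<open>auto simp: sum_distrib_left intro: Vandermonde_power_sum_eq_0\<close>)
  moreover have "g x = of_bool (\<forall>j\<in>{1..r}. eval_mpoly (f j) x = 0)" for x
    unfolding g_def \<open>q = CARD('a)\<close> one_minus_power_card by (auto intro: prod.neutral)
  \<comment> \<open>Summing an indicator counts its support, here only as an element of the field,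
    that is, modulo \<open>p\<close>.\<close>
  ultimately have "of_nat (card {x \<in> PiE {1..n} X. \<forall>j\<in>{1..r}. eval_mpoly (f j) x = 0}) = (0 :: 'a)"
    using fin by (simp add: Int_def)
  then show ?thesis
    by (simp add: of_nat_eq_0_iff_char_dvd \<open>p = CHAR('a)\<close>)
qed

end
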